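(* Let $0<\beta<1$ and fix one of the signs $\pm$. Suppose that the Kolwankar–Gangal local fractional derivative $\mathcal{D}^{\beta}_{KG,\pm}f(a)$ exists finitely and that the related Riemann–Liouville derivative is summable, in the sense that $f$ belongs to the space of summable fractional derivatives $E^{\beta}_{a,\pm}$ on an interval with endpoint $a$ (of the form $[a,a+\delta]$ for the sign $+$ and $[a-\delta,a]$ for the sign $-$, $\delta>0$). Then $f$ is $\beta$-differentiable at $a$ and $$\mathcal{D}^{\beta}_{KG,\pm}f(a)=\Gamma(1+\beta)\,\upsilon^{\beta}_{\pm}f(a).$$
   Context: $f:\mathbb{R}\to\mathbb{R}$. For $\epsilon>0$ put $\Delta^{+}_{\epsilon}[f](x)=f(x+\epsilon)-f(x)$ and $\Delta^{-}_{\epsilon}[f](x)=f(x)-f(x-\epsilon)$. The fractional velocity of order $\beta$ is $\upsilon^{\beta}_{\pm}f(x)=\lim_{\epsilon\to0^+}\Delta^{\pm}_{\epsilon}[f](x)/\epsilon^{\beta}$. $f$ is $\beta$-differentiable at $x$ if at least one of $\upsilon^{\beta}_{\pm}f(x)$ exists finitely (in the displayed formula $\upsilon^\beta_\pm f(a)$ with the fixed sign is asserted to exist finitely). Riemann–Liouville integrals and derivatives with base point $a$: for $\alpha>0$, $$I^{\alpha}_{a+}g(x)=\frac{1}{\Gamma(\alpha)}\int_{a}^{x}g(t)(x-t)^{\alpha-1}dt\ (x>a),\qquad I^{\alpha}_{-a}g(x)=\frac{1}{\Gamma(\alpha)}\int_{x}^{a}g(t)(t-x)^{\alpha-1}dt\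 (x<a),$$ $$\mathcal{D}^{\beta}_{a+}g=\frac{d}{dx}I^{1-\beta}_{a+}g,\qquad \mathcal{D}^{\beta}_{-a}g=-\frac{d}{dx}I^{1-\beta}_{-a}g .$$ Kolwankar–Gangal local fractional derivatives at $a$: $$\mathcal{D}^{\beta}_{KG,+}f(a)=\lim_{x\to a^{+}}\mathcal{D}^{\beta}_{a+}\bigl(f-f(a)\bigr)(x),\qquad \mathcal{D}^{\beta}_{KG,-}f(a)=\lim_{x\to a^{-}}\mathcal{D}^{\beta}_{-a}\bigl(f(a)-f\bigr)(x).$$ The space $E^{\beta}_{a,+}(J)$ (respectively $E^{\beta}_{a,-}(J)$) of summable fractional derivatives on a compact interval $J$ with left (respectively right) endpoint $a$ consists of the functions $f\in L^{1}(J)$ such that $I^{1-\beta}_{a+}f$ (respectively $I^{1-\beta}_{-a}f$) is absolutely continuous on $J$. Here $\Gamma$ is Euler's Gamma function.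
   Formalization: The claim fails for arbitrary pointwise f (indicator of {1/n}, a=0); it is proved for some g equal to f a.e. on the interval with g(a)=f(a), and for f itself if f is continuous at all points near a on the chosen side; the fractional integral at a is taken to be 0. *)

theory Defs
  imports "HOL-Analysis.Analysis"
begin

datatype side = Plus | Minus

fun side_filter :: "side \<Rightarrow> real \<Rightarrow> real filter" where
  "side_filter Plus a = at_right a"
| "side_filter Minus a = at_left a"

fun side_interval :: "side \<Rightarrow> real \<Rightarrow> real \<Rightarrow> real set" where
  "side_interval Plus a \<delta> = {a..a + \<delta>}"
| "side_interval Minus a \<delta> = {a - \<delta>..a}"


fun frac_diff :: "side \<Rightarrow> real \<Rightarrow> (real \<Rightarrow> real) \<Rightarrow> real \<Rightarrow> real" where
  "frac_diff Plus \<epsilon> f x = f (x + \<epsilon>) - f x"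
| "frac_diff Minus \<epsilon> f x = f x - f (x - \<epsilon>)"

definition has_frac_velocity :: "side \<Rightarrow> real \<Rightarrow> (real \<Rightarrow> real) \<Rightarrow> real \<Rightarrow> real \<Rightarrow> bool" where
  "has_frac_velocity s \<beta> f x v \<longleftrightarrow>
     ((\<lambda>\<epsilon>. frac_diff s \<epsilon> f x / \<epsilon> powr \<beta>) \<longlongrightarrow> v) (at_right 0)"

definition beta_differentiable :: "real \<Rightarrow> (real \<Rightarrow> real) \<Rightarrow> real \<Rightarrow> bool" where
  "beta_differentiable \<beta> f x \<longleftrightarrow> (\<exists>s v. has_frac_velocity s \<beta> f x v)"


fun RL_domain :: "side \<Rightarrow> real \<Rightarrow> real \<Rightarrow> real set" where
  "RL_domain Plus a x = {a..x}"
| "RL_domain Minus a x = {x..a}"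

fun RL_kernel :: "side \<Rightarrow> real \<Rightarrow> real \<Rightarrow> real \<Rightarrow> real" where
  "RL_kernel Plus \<alpha> x t = (x - t) powr (\<alpha> - 1)"
| "RL_kernel Minus \<alpha> x t = (t - x) powr (\<alpha> - 1)"

definition RL_integrable :: "side \<Rightarrow> real \<Rightarrow> real \<Rightarrow> (real \<Rightarrow> real) \<Rightarrow> real \<Rightarrow> bool" where
  "RL_integrable s a \<alpha> g x \<longleftrightarrow>
     set_integrable lebesgue (RL_domain s a x) (\<lambda>t. g t * RL_kernel s \<alpha> x t)"

(* At x = a the domain is a single point, so the value there is 0. *)
definition RL_integral :: "side \<Rightarrow> real \<Rightarrow> real \<Rightarrow> (real \<Rightarrow> real) \<Rightarrow> real \<Rightarrow> real" where
  "RL_integral s a \<alpha> g x =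
     1 / Gamma \<alpha> * (LINT t : RL_domain s a x | lebesgue. g t * RL_kernel s \<alpha> x t)"

(* The integrability clause keeps the value 0 of a divergent integral out of the derivative. *)
definition RL_differentiable :: "side \<Rightarrow> real \<Rightarrow> real \<Rightarrow> (real \<Rightarrow> real) \<Rightarrow> real \<Rightarrow> bool" where
  "RL_differentiable s a \<beta> g x \<longleftrightarrow>
     (\<forall>\<^sub>F y in nhds x. RL_integrable s a (1 - \<beta>) g y) \<and>
     RL_integral s a (1 - \<beta>) g differentiable (at x)"

fun RL_deriv :: "side \<Rightarrow> real \<Rightarrow> real \<Rightarrow> (real \<Rightarrow> real) \<Rightarrow> real \<Rightarrow> real" where
  "RL_deriv Plus a \<beta> g x = deriv (RL_integral Plus a (1 - \<beta>) g) x"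
| "RL_deriv Minus a \<beta> g x = - deriv (RL_integral Minus a (1 - \<beta>) g) x"


fun KG_increment :: "side \<Rightarrow> (real \<Rightarrow> real) \<Rightarrow> real \<Rightarrow> real \<Rightarrow> real" where
  "KG_increment Plus f a = (\<lambda>t. f t - f a)"
| "KG_increment Minus f a = (\<lambda>t. f a - f t)"

definition has_KG_derivative :: "side \<Rightarrow> real \<Rightarrow> (real \<Rightarrow> real) \<Rightarrow> real \<Rightarrow> real \<Rightarrow> bool" where
  "has_KG_derivative s \<beta> f a D \<longleftrightarrow>
     (\<forall>\<^sub>F x in side_filter s a. RL_differentiable s a \<beta> (KG_increment s f a) x) \<and>
     (RL_deriv s a \<beta> (KG_increment s f a) \<longlongrightarrow> D) (side_filter s a)"


(* Absolute continuity of a real function on an interval; the HOL-Analysis constant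
   absolutely_continuous is the notion for measures. *)
definition abs_continuous_on :: "real set \<Rightarrow> (real \<Rightarrow> real) \<Rightarrow> bool" where
  "abs_continuous_on J F \<longleftrightarrow>
     (\<forall>\<epsilon>>0. \<exists>\<eta>>0. \<forall>(n::nat) u v.
        (\<forall>i<n. u i \<le> v i \<and> u i \<in> J \<and> v i \<in> J) \<and>
        disjoint_family_on (\<lambda>i. {u i<..<v i}) {..<n} \<and>
        (\<Sum>i<n. v i - u i) < \<eta>
        \<longrightarrow> (\<Sum>i<n. \<bar>F (v i) - F (u i)\<bar>) < \<epsilon>)"

definition summable_frac_deriv_space :: "side \<Rightarrow> real \<Rightarrow> real \<Rightarrow> real set \<Rightarrow> (real \<Rightarrow> real) set" where
  "summable_frac_deriv_space s \<beta> a J =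
     {f. set_integrable lebesgue J f \<and>
         (\<forall>x\<in>J. RL_integrable s a (1 - \<beta>) f x) \<and>
         abs_continuous_on J (RL_integral s a (1 - \<beta>) f)}"

(* Elements of the preceding space are determined by their integrals only up to null sets.
   Changing f on a null set not containing a affects neither membership nor the
   Kolwankar-Gangal derivative at a, but it can destroy the pointwise limit defining the
   fractional velocity.  A version of f therefore keeps the value at a and agrees with f
   almost everywhere on J. *)
definition version_at :: "real \<Rightarrow> real set \<Rightarrow> (real \<Rightarrow> real) \<Rightarrow> (real \<Rightarrow> real) \<Rightarrow> bool" where
  "version_at a J f g \<longleftrightarrow> g a = f a \<and> (AE x in lebesgue. x \<in> J \<longrightarrow> g x = f x)"

end

theory Submission
  imports Defs
begin

text \<open>Reflection and translation reduce both signs to the increment \<open>h\<close> of \<open>f\<close> on \<open>[0, \<delta>]\<close>.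
  Absolute continuity is only needed for \<open>F = I\<^sup>1\<^sup>-\<^sup>\<beta> h\<close> to vanish continuously at 0.
  If \<open>F' \<ge> c\<close> near 0, then \<open>F(y) - c y\<close> is increasing and is the fractional integral of
  \<open>h(t) - c t\<^sup>\<beta> / \<Gamma>(1 + \<beta>)\<close>. Applying \<open>I\<^sup>\<beta>\<close>, which preserves monotone functions vanishing
  at 0, shows that the ordinary antiderivative of this difference is increasing, so the difference
  is nonnegative almost everywhere. Taking \<open>c\<close> close to \<open>D\<close>, and arguing likewise for \<open>-h\<close>,
  squeezes \<open>h(t) / t\<^sup>\<beta>\<close> to \<open>D / \<Gamma>(1 + \<beta>)\<close> almost everywhere near 0. The exceptional null set is
  absorbed by changing the version of \<open>f\<close>, and is empty where \<open>f\<close> is continuous.\<close>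

subsection \<open>Composition of fractional integrals\<close>

text \<open>With the kernel extended by zero, Riemann--Liouville integrals become convolutions on the
  whole line.\<close>

definition pos_powr :: "real \<Rightarrow> real \<Rightarrow> real" where
  "pos_powr c u = (if 0 < u then u powr c else 0)"

lemma pos_powr_nonneg [simp]: "0 \<le> pos_powr c u"
  by (simp add: pos_powr_def)

lemma borel_measurable_pos_powr [measurable]: "pos_powr c \<in> borel_measurable borel"
  unfolding pos_powr_def by measurable

lemma pos_powr_scale: "0 < m \<Longrightarrow> pos_powr c (m * u) = m powr c * pos_powr c u"
  by (simp add: pos_powr_def zero_less_mult_iff powr_mult)

lemma has_bochner_integral_Beta:
  assumes "0 < \<alpha>" "0 < (\<beta>::real)"
  shows "has_bochner_integral lborel (\<lambda>u. pos_powr (\<alpha> - 1) u * pos_powr (\<beta> - 1) (1 - u)) (Beta \<alpha> \<beta>)"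
proof (rule has_bochner_integral_nn_integral)
  have "integral\<^sup>N lborel (\<lambda>u. ennreal (u powr (\<alpha> - 1) * (1 - u) powr (\<beta> - 1)) * indicator {0..1} u)
      = ennreal (Beta \<alpha> \<beta>)"
    by (rule nn_integral_has_integral_lebesgue') (auto intro: has_integral_Beta_real assms)
  \<comment> \<open>The two functions agree at the endpoints as well, because \<open>powr\<close>
    with base 0 is 0.\<close>
  also have "(\<lambda>u. ennreal (u powr (\<alpha> - 1) * (1 - u) powr (\<beta> - 1)) * indicator {0..1} u) =
      (\<lambda>u. ennreal (pos_powr (\<alpha> - 1) u * pos_powr (\<beta> - 1) (1 - u)))"
    by (auto simp: pos_powr_def indicator_def fun_eq_iff)
  finally show "(\<integral>\<^sup>+u. ennreal (pos_powr (\<alpha> - 1) u * pos_powr (\<beta> - 1) (1 - u)) \<partial>lborel)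
      = ennreal (Beta \<alpha> \<beta>)" .
  show "0 \<le> Beta \<alpha> \<beta>"
    using assms by (simp add: Beta_def)
qed auto

text \<open>For \<open>t < x\<close> the substitution \<open>s = t + m * u\<close> with
  \<open>m = x - t\<close> rescales to the unit interval and leaves Euler's Beta integral. Otherwise
  the two positivity conditions exclude each other and both sides are 0.\<close>

lemma has_bochner_integral_pos_powr_convolution:
  assumes "0 < \<alpha>" "0 < \<beta>"
  shows "has_bochner_integral lborel (\<lambda>s. pos_powr (\<alpha> - 1) (s - t) * pos_powr (\<beta> - 1) (x - s))
           (Beta \<alpha> \<beta> * pos_powr (\<alpha> + \<beta> - 1) (x - t))"
proof (cases "t < x")
  case True
  define m where "m = x - t"
  have m: "0 < m" using True by (simp add: m_def)
  let ?F = "\<lambda>s. pos_powr (\<alpha> - 1) (s - t) * pos_powr (\<beta> - 1) (x - s)"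
  have "?F (t + m * u) = m powr (\<alpha> + \<beta> - 2) * (pos_powr (\<alpha> - 1) u * pos_powr (\<beta> - 1) (1 - u))" for u
  proof -
    have "x - (t + m * u) = m * (1 - u)" by (simp add: m_def algebra_simps)
    then have "?F (t + m * u) = (m powr (\<alpha> - 1) * m powr (\<beta> - 1)) *
        (pos_powr (\<alpha> - 1) u * pos_powr (\<beta> - 1) (1 - u))"
      using m by (simp add: pos_powr_scale)
    also have "m powr (\<alpha> - 1) * m powr (\<beta> - 1) = m powr (\<alpha> + \<beta> - 2)"
      by (simp add: powr_add[symmetric])
    finally show ?thesis .
  qed
  then have "has_bochner_integral lborel (\<lambda>u. ?F (t + m * u)) (m powr (\<alpha> + \<beta> - 2) * Beta \<alpha> \<beta>)"
    by (auto intro!: has_bochner_integral_mult_right has_bochner_integral_Beta assms)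
  moreover have "m powr (\<alpha> + \<beta> - 2) * Beta \<alpha> \<beta>
      = (Beta \<alpha> \<beta> * pos_powr (\<alpha> + \<beta> - 1) (x - t)) /\<^sub>R \<bar>m\<bar>"
    using m by (simp add: pos_powr_def flip: m_def) (simp add: powr_diff field_simps powr_add power2_eq_square)
  ultimately show ?thesis
    using m by (subst lborel_has_bochner_integral_real_affine_iff[of m _ _ t]) auto
next
  case False
  then have "(\<lambda>s. pos_powr (\<alpha> - 1) (s - t) * pos_powr (\<beta> - 1) (x - s)) = (\<lambda>_. 0)"
    by (auto simp: pos_powr_def)
  with False show ?thesis
    by (simp add: pos_powr_def has_bochner_integral_zero)
qed

text \<open>Up to Gamma factors this is the semigroup law of fractional integration. Fubini brings
  the integration in \<open>s\<close> inside, where it is a Beta convolution; since the kernels are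
  nonnegative, \<open>int\<close> yields absolute integrability on the product.\<close>

lemma
  fixes k :: "real \<Rightarrow> real"
  assumes pos: "0 < \<alpha>" "0 < \<beta>" and k: "k \<in> borel_measurable borel"
    and int: "integrable lborel (\<lambda>t. k t * pos_powr (\<alpha> + \<beta> - 1) (x - t))"
  shows integrable_pos_powr_semigroup_lborel:
      "integrable lborel (\<lambda>s. (\<integral>t. k t * pos_powr (\<alpha> - 1) (s - t) \<partial>lborel) * pos_powr (\<beta> - 1) (x - s))"
    and integral_pos_powr_semigroup_lborel:
      "(\<integral>s. (\<integral>t. k t * pos_powr (\<alpha> - 1) (s - t) \<partial>lborel) * pos_powr (\<beta> - 1) (x - s) \<partial>lborel)
        = Beta \<alpha> \<beta> * (\<integral>t. k t * pos_powr (\<alpha> + \<beta> - 1) (x - t) \<partial>lborel)"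
proof -
  note [measurable] = k
  let ?q = "\<lambda>t s. pos_powr (\<alpha> - 1) (s - t) * pos_powr (\<beta> - 1) (x - s)"
  have q: "integrable lborel (?q t)" "(\<integral>s. ?q t s \<partial>lborel) = Beta \<alpha> \<beta> * pos_powr (\<alpha> + \<beta> - 1) (x - t)" for t
    using has_bochner_integral_pos_powr_convolution[OF pos, of t x]
    by (simp_all add: has_bochner_integral_iff)
  have "integrable lborel (\<lambda>t. \<integral>s. norm (k t * ?q t s) \<partial>lborel)"
  proof -
    have "(\<integral>s. norm (k t * ?q t s) \<partial>lborel) = Beta \<alpha> \<beta> * norm (k t * pos_powr (\<alpha> + \<beta> - 1) (x - t))" for t
      by (simp add: norm_mult abs_mult q)
    then show ?thesis using int by simp
  qed
  then have F: "integrable (lborel \<Otimes>\<^sub>M lborel) (\<lambda>(t, s). k t * ?q t s)"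
    by (intro lborel_pair.Fubini_integrable) (auto simp: q(1))
  have eq: "(\<integral>t. k t * ?q t s \<partial>lborel)
      = (\<integral>t. k t * pos_powr (\<alpha> - 1) (s - t) \<partial>lborel) * pos_powr (\<beta> - 1) (x - s)" for s
    by (simp add: mult.assoc[symmetric])
  show "integrable lborel (\<lambda>s. (\<integral>t. k t * pos_powr (\<alpha> - 1) (s - t) \<partial>lborel) * pos_powr (\<beta> - 1) (x - s))"
    using lborel_pair.integrable_snd[OF F] by (simp add: eq)
  show "(\<integral>s. (\<integral>t. k t * pos_powr (\<alpha> - 1) (s - t) \<partial>lborel) * pos_powr (\<beta> - 1) (x - s) \<partial>lborel)
      = Beta \<alpha> \<beta> * (\<integral>t. k t * pos_powr (\<alpha> + \<beta> - 1) (x - t) \<partial>lborel)"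
  proof -
    have "k t * (Beta \<alpha> \<beta> * pos_powr (\<alpha> + \<beta> - 1) (x - t)) = Beta \<alpha> \<beta> * (k t * pos_powr (\<alpha> + \<beta> - 1) (x - t))" for t
      by (rule mult.left_commute)
    then show ?thesis
      using lborel_pair.Fubini_integral[OF F] by (simp only: eq q(2) integral_mult_right_zero)
  qed
qed

text \<open>The Borel case applies after replacing \<open>k\<close> by a Borel function equal to it
  almost everywhere. The inner integrals then agree for every \<open>s\<close>, not just for almost
  every \<open>s\<close>.\<close>

lemma
  fixes k :: "real \<Rightarrow> real"
  assumes pos: "0 < \<alpha>" "0 < \<beta>" and k: "k \<in> borel_measurable lebesgue"
    and int: "integrable lebesgue (\<lambda>t. k t * pos_powr (\<alpha> + \<beta> - 1) (x - t))"
  shows integrable_pos_powr_semigroup: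
      "integrable lebesgue (\<lambda>s. (\<integral>t. k t * pos_powr (\<alpha> - 1) (s - t) \<partial>lebesgue) * pos_powr (\<beta> - 1) (x - s))"
    and integral_pos_powr_semigroup:
      "(\<integral>s. (\<integral>t. k t * pos_powr (\<alpha> - 1) (s - t) \<partial>lebesgue) * pos_powr (\<beta> - 1) (x - s) \<partial>lebesgue)
        = Beta \<alpha> \<beta> * (\<integral>t. k t * pos_powr (\<alpha> + \<beta> - 1) (x - t) \<partial>lebesgue)"
proof -
  obtain k0 where k0 [measurable]: "k0 \<in> borel_measurable lborel" and "AE t in lborel. k t = k0 t"
    using completion_ex_borel_measurable_real[OF k] by auto
  then have AE: "AE t in lebesgue. k t = k0 t"
    by (simp add: AE_completion)
  have q: "(\<lambda>t. pos_powr c (s - t)) \<in> borel_measurable lebesgue" for c s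
    by (intro measurable_completion) simp
  have k0l: "k0 \<in> borel_measurable lebesgue"
    using k0 by (rule measurable_completion)
  have eq: "(\<integral>t. k t * pos_powr c (s - t) \<partial>lebesgue) = (\<integral>t. k0 t * pos_powr c (s - t) \<partial>lborel)" for c s
  proof -
    have "(\<integral>t. k t * pos_powr c (s - t) \<partial>lebesgue) = (\<integral>t. k0 t * pos_powr c (s - t) \<partial>lebesgue)"
      using AE by (intro integral_cong_AE borel_measurable_times k k0l q) auto
    then show ?thesis by (simp add: integral_completion)
  qed
  have "integrable lebesgue (\<lambda>t. k0 t * pos_powr (\<alpha> + \<beta> - 1) (x - t))"
    using AE by (intro integrable_cong_AE_imp[OF int] borel_measurable_times k0l q) auto
  then have "integrable lborel (\<lambda>t. k0 t * pos_powr (\<alpha> + \<beta> - 1) (x - t))"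
    by (subst (asm) integrable_completion) auto
  note * = integrable_pos_powr_semigroup_lborel[OF pos _ this]
    integral_pos_powr_semigroup_lborel[OF pos _ this]
  have i: "integrable lborel (\<lambda>s. (\<integral>t. k t * pos_powr (\<alpha> - 1) (s - t) \<partial>lebesgue) * pos_powr (\<beta> - 1) (x - s))"
    using *(1) k0 by (simp add: eq)
  note m = borel_measurable_integrable[OF i]
  show "integrable lebesgue (\<lambda>s. (\<integral>t. k t * pos_powr (\<alpha> - 1) (s - t) \<partial>lebesgue) * pos_powr (\<beta> - 1) (x - s))"
    using i integrable_completion[OF m] by simp
  show "(\<integral>s. (\<integral>t. k t * pos_powr (\<alpha> - 1) (s - t) \<partial>lebesgue) * pos_powr (\<beta> - 1) (x - s) \<partial>lebesgue)
        = Beta \<alpha> \<beta> * (\<integral>t. k t * pos_powr (\<alpha> + \<beta> - 1) (x - t) \<partial>lebesgue)"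
    using *(2) k0 unfolding integral_completion[OF m] by (simp add: eq)
qed

subsection \<open>Monotone fractional integrals\<close>

lemma RL_integral_0 [simp]: "RL_integral s a \<alpha> g a = 0"
proof -
  \<comment> \<open>At \<open>t = a\<close> the kernel is a power with base 0, hence 0, so the
    integrand vanishes at every point.\<close>
  have "indicator (RL_domain s a a) t *\<^sub>R (g t * RL_kernel s \<alpha> a t) = 0" for t
    by (cases s) (auto simp: indicator_def)
  then show ?thesis
    unfolding RL_integral_def set_lebesgue_integral_def by (simp only:) simp
qed

text \<open>The antiderivative of \<open>k\<close> is \<open>I\<^sup>1\<^sup>-\<^sup>\<alpha> (I\<^sup>\<alpha> k)\<close>; since the kernel is positive, it inherits
  monotonicity from \<open>I\<^sup>\<alpha> k\<close>, and differentiating it recovers \<open>k\<close> almost everywhere.\<close>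

lemma AE_nonneg_of_mono_RL_integral:
  assumes \<alpha>: "0 < \<alpha>" "\<alpha> < 1" and k: "set_integrable lebesgue {0..\<eta>} k"
    and mono: "mono_on {0..\<eta>} (RL_integral Plus 0 \<alpha> k)"
  shows "AE x in lebesgue. 0 < x \<and> x < \<eta> \<longrightarrow> 0 \<le> k x"
proof -
  define k' where "k' t = indicator {0..\<eta>} t *\<^sub>R k t" for t
  have k'[simp]: "integrable lebesgue k'"
    using k unfolding set_integrable_def k'_def .
  define G where "G s = (\<integral>t. k' t * pos_powr (\<alpha> - 1) (s - t) \<partial>lebesgue)" for s
  have G_RL: "G s = Gamma \<alpha> * RL_integral Plus 0 \<alpha> k s" if "s \<le> \<eta>" for s
  proof -
    have "k' t * pos_powr (\<alpha> - 1) (s - t)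
        = indicator (RL_domain Plus 0 s) t *\<^sub>R (k t * RL_kernel Plus \<alpha> s t)" for t
      using that by (auto simp: k'_def pos_powr_def indicator_def)
    moreover have "Gamma \<alpha> \<noteq> 0" using Gamma_real_pos[OF \<alpha>(1)] by simp
    ultimately show ?thesis
      by (simp add: G_def RL_integral_def set_lebesgue_integral_def)
  qed
  have G_neg: "G s = 0" if "s \<le> 0" for s
  proof -
    have "k' t * pos_powr (\<alpha> - 1) (s - t) = 0" for t
      using that by (auto simp: k'_def pos_powr_def indicator_def)
    then show ?thesis unfolding G_def by (simp only:) simp
  qed
  have G_mono: "G r \<le> G s" if "r \<le> s" "s \<le> \<eta>" for r s
  proof -
    have *: "G r \<le> G s" if "0 \<le> r" "r \<le> s" "s \<le> \<eta>" for r s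
    proof -
      have "RL_integral Plus 0 \<alpha> k r \<le> RL_integral Plus 0 \<alpha> k s"
        using that by (intro mono_onD[OF mono]) auto
      then show ?thesis
        using that Gamma_real_pos[OF \<alpha>(1)] by (simp add: G_RL)
    qed
    \<comment> \<open>In the remaining cases \<open>r\<close> is negative, where
      \<open>G r = 0 = G 0\<close>. Negative arguments matter because \<open>G\<close> is translated
      below.\<close>
    show ?thesis
      using *[of r s] *[of 0 s] that G_neg[of r] G_neg[of s] G_neg[of 0] by linarith
  qed
  \<comment> \<open>The exponent is \<open>\<alpha> + (1 - \<alpha>) - 1\<close>, and
    \<open>pos_powr 0\<close> is the indicator of the positive half-line, so \<open>W\<close> is the
    antiderivative of \<open>k'\<close>.\<close>
  define W where "W x = (\<integral>t. k' t * pos_powr 0 (x - t) \<partial>lebesgue)" for x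
  have W_int: "integrable lebesgue (\<lambda>t. k' t * pos_powr 0 (x - t))" for x
  proof -
    have "integrable lebesgue (\<lambda>t. indicator {..<x} t *\<^sub>R k' t)"
      by (rule integrable_mult_indicator) auto
    also have "(\<lambda>t. indicator {..<x} t *\<^sub>R k' t) = (\<lambda>t. k' t * pos_powr 0 (x - t))"
      by (auto simp: fun_eq_iff pos_powr_def indicator_def)
    finally show ?thesis .
  qed
  have B: "0 < Beta \<alpha> (1 - \<alpha>)"
    using \<alpha> by (simp add: Beta_def Gamma_real_pos)
  let ?q = "pos_powr ((1 - \<alpha>) - 1)"
  \<comment> \<open>The reflection \<open>s = x - u\<close> moves the dependence on \<open>x\<close>
    from the kernel into \<open>G\<close>, so that monotonicity of \<open>G\<close> can be used
    under the integral.\<close>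
  have semi: "integrable lebesgue (\<lambda>u. G (x - u) * ?q u) \<and>
      (\<integral>u. G (x - u) * ?q u \<partial>lebesgue) = Beta \<alpha> (1 - \<alpha>) * W x" for x
  proof -
    let ?f = "\<lambda>s. G s * ?q (x - s)"
    have "integrable lebesgue ?f" "(\<integral>s. ?f s \<partial>lebesgue) = Beta \<alpha> (1 - \<alpha>) * W x"
      using integrable_pos_powr_semigroup[of \<alpha> "1 - \<alpha>" k' x]
        integral_pos_powr_semigroup[of \<alpha> "1 - \<alpha>" k' x] \<alpha> W_int
        borel_measurable_integrable[OF k']
      by (simp_all add: G_def W_def)
    then show ?thesis
      using lebesgue_integral_real_affine[of "-1" ?f x] lebesgue_integrable_real_affine_iff[of "-1" ?f x]
      by simp
  qed
  have W_mono: "W x \<le> W y" if "x \<le> y" "y \<le> \<eta>" for x y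
  proof -
    have "(\<integral>u. G (x - u) * ?q u \<partial>lebesgue) \<le> (\<integral>u. G (y - u) * ?q u \<partial>lebesgue)"
    proof (rule integral_mono)
      show "G (x - u) * ?q u \<le> G (y - u) * ?q u" for u
        using that G_mono[of "x - u" "y - u"] by (cases "0 < u") (auto simp: pos_powr_def intro!: mult_right_mono)
    qed (use semi in auto)
    then show ?thesis using semi B by simp
  qed
  have k'_set: "set_integrable lebesgue {c..d} k'" for c d
    unfolding set_integrable_def by (rule integrable_mult_indicator) auto
  have W_diff: "integral {x..y} k' = W y - W x" if "x < y" for x y
  proof -
    have "W y - W x = (\<integral>t. k' t * pos_powr 0 (y - t) - k' t * pos_powr 0 (x - t) \<partial>lebesgue)"
      unfolding W_def by (rule Bochner_Integration.integral_diff[symmetric]; rule W_int)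
    also have "\<dots> = (\<integral>t. indicator {x..y} t *\<^sub>R k' t \<partial>lebesgue)"
    proof (rule integral_cong_AE)
      \<comment> \<open>The integrands can differ only at \<open>y\<close>, which the closed
        interval contains but \<open>pos_powr 0 (y - t)\<close> excludes.\<close>
      have "AE t in lebesgue. t \<noteq> y"
        by (intro AE_completion AE_lborel_singleton)
      then show "AE t in lebesgue. k' t * pos_powr 0 (y - t) - k' t * pos_powr 0 (x - t)
          = indicator {x..y} t *\<^sub>R k' t"
        by eventually_elim (use that in \<open>auto simp: pos_powr_def indicator_def\<close>)
    qed (use W_int k'_set in \<open>auto simp: set_integrable_def intro!: borel_measurable_integrable\<close>)
    also have "\<dots> = integral {x..y} k'"
      using set_lebesgue_integral_eq_integral(2)[OF k'_set] by (simp add: set_lebesgue_integral_def)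
    finally show ?thesis by simp
  qed
  \<comment> \<open>Lebesgue differentiation: off a null set \<open>N\<close>, the averages of
    \<open>k'\<close> over intervals starting at \<open>x\<close> tend to
    \<open>k' x\<close>.\<close>
  have "k' integrable_on cbox c d" for c d :: real
    using set_lebesgue_integral_eq_integral(1)[OF k'_set] by simp
  then obtain N where N: "negligible N" and
    lim: "\<And>x e. x \<notin> N \<Longrightarrow> 0 < e \<Longrightarrow> \<exists>d>0. \<forall>h. 0 < h \<and> h < d \<longrightarrow>
      norm (integral (cbox x (x + h *\<^sub>R One)) k' /\<^sub>R h ^ DIM(real) - k' x) < e"
    using integrable_ccontinuous_explicit[of k'] by metis
  have "0 \<le> k x" if x: "0 < x" "x < \<eta>" "x \<notin> N" for x
  proof (rule ccontr)
    assume neg: "\<not> 0 \<le> k x"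
    \<comment> \<open>With tolerance \<open>- k x\<close>, a negative value of \<open>k\<close>
      forces negative averages near \<open>x\<close>, against the monotonicity of
      \<open>W\<close>.\<close>
    from lim[OF x(3), of "- k x"] neg obtain d where "0 < d" and
      d: "\<And>h. 0 < h \<Longrightarrow> h < d \<Longrightarrow> \<bar>integral {x..x + h} k' / h - k' x\<bar> < - k x"
      by (auto simp: divide_inverse mult.commute)
    \<comment> \<open>The bound by \<open>\<eta> - x\<close> keeps \<open>x + h\<close> in the range
      where \<open>W\<close> is known to be increasing.\<close>
    define h where "h = min (d / 2) (\<eta> - x)"
    have h: "0 < h" "h < d" "x + h \<le> \<eta>"
      using \<open>0 < d\<close> x by (auto simp: h_def)
    have "0 \<le> integral {x..x + h} k' / h"
      using W_mono[of x "x + h"] W_diff[of x "x + h"] h by simp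
    moreover have "k' x = k x" using x by (simp add: k'_def)
    ultimately show False using d[OF h(1,2)] by linarith
  qed
  then have "{x \<in> space lebesgue. \<not> (0 < x \<and> x < \<eta> \<longrightarrow> 0 \<le> k x)} \<subseteq> N" by auto
  then show ?thesis
    using N by (auto intro!: AE_I' simp: negligible_iff_null_sets)
qed

subsection \<open>Fractional integrals with a prescribed derivative at the base point\<close>

lemma has_bochner_integral_completion:
  fixes f :: "'a \<Rightarrow> 'b::{banach, second_countable_topology}"
  assumes "has_bochner_integral M f i"
  shows "has_bochner_integral (completion M) f i"
proof -
  have i: "integrable M f" "integral\<^sup>L M f = i"
    using assms unfolding has_bochner_integral_iff by blast+
  note m = borel_measurable_integrable[OF i(1)]
  show ?thesis
    unfolding has_bochner_integral_iff integrable_completion[OF m] integral_completion[OF m] using i by blast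
qed

text \<open>This is the Beta convolution based at 0. Only the values of \<open>g\<close> at positive
  arguments are prescribed, so that the constant 1 is covered by \<open>p = 0\<close> although
  \<open>0 powr 0\<close> is 0.\<close>

lemma
  assumes "0 < \<alpha>" "-1 < p" and g: "g \<in> borel_measurable borel" "\<And>t. 0 < t \<Longrightarrow> g t = t powr p"
  shows RL_integrable_powr: "RL_integrable Plus 0 \<alpha> g y"
    and RL_integral_powr: "0 < y \<Longrightarrow>
      RL_integral Plus 0 \<alpha> g y = Gamma (p + 1) / Gamma (p + 1 + \<alpha>) * y powr (p + \<alpha>)"
proof -
  note [measurable] = g(1)
  let ?f = "\<lambda>s. indicator (RL_domain Plus 0 y) s *\<^sub>R (g s * RL_kernel Plus \<alpha> y s)"
  have "has_bochner_integral lborel (\<lambda>s. pos_powr p s * pos_powr (\<alpha> - 1) (y - s))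
      (Beta (p + 1) \<alpha> * pos_powr (p + \<alpha>) y)"
    using has_bochner_integral_pos_powr_convolution[of "p + 1" \<alpha> 0 y] assms(1,2)
    by (simp add: algebra_simps)
  moreover have "AE s in lborel. pos_powr p s * pos_powr (\<alpha> - 1) (y - s) = ?f s"
    using AE_lborel_singleton[of 0]
    by eventually_elim (auto simp: pos_powr_def indicator_def g(2))
  ultimately have "has_bochner_integral lborel ?f (Beta (p + 1) \<alpha> * pos_powr (p + \<alpha>) y)"
    by (subst (asm) has_bochner_integral_cong_AE) auto
  then have *: "has_bochner_integral lebesgue ?f (Beta (p + 1) \<alpha> * pos_powr (p + \<alpha>) y)"
    by (rule has_bochner_integral_completion)
  then show "RL_integrable Plus 0 \<alpha> g y"
    unfolding RL_integrable_def set_integrable_def has_bochner_integral_iff by blast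
  show "RL_integral Plus 0 \<alpha> g y
      = Gamma (p + 1) / Gamma (p + 1 + \<alpha>) * y powr (p + \<alpha>)" if "0 < y"
  proof -
    have "RL_integral Plus 0 \<alpha> g y = 1 / Gamma \<alpha> * (Beta (p + 1) \<alpha> * pos_powr (p + \<alpha>) y)"
      unfolding RL_integral_def set_lebesgue_integral_def has_bochner_integral_integral_eq[OF *] ..
    then show ?thesis
      using that Gamma_real_pos[OF assms(1)] by (simp add: Beta_def pos_powr_def)
  qed
qed

lemma RL_integrable_cmult:
  "RL_integrable s a \<alpha> g x \<Longrightarrow> RL_integrable s a \<alpha> (\<lambda>t. c * g t) x"
  unfolding RL_integrable_def by (simp add: mult.assoc)

lemma RL_integral_cmult:
  "RL_integral s a \<alpha> (\<lambda>t. c * g t) x = c * RL_integral s a \<alpha> g x"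
  unfolding RL_integral_def by (simp add: mult.assoc)

lemma RL_integrable_diff:
  "RL_integrable s a \<alpha> g x \<Longrightarrow> RL_integrable s a \<alpha> h x \<Longrightarrow> RL_integrable s a \<alpha> (\<lambda>t. g t - h t) x"
  unfolding RL_integrable_def by (simp add: left_diff_distrib)

lemma RL_integral_diff:
  "RL_integrable s a \<alpha> g x \<Longrightarrow> RL_integrable s a \<alpha> h x \<Longrightarrow>
    RL_integral s a \<alpha> (\<lambda>t. g t - h t) x = RL_integral s a \<alpha> g x - RL_integral s a \<alpha> h x"
  unfolding RL_integral_def RL_integrable_def
  by (simp add: left_diff_distrib set_integral_diff(2) diff_divide_distrib)

text \<open>Since \<open>I\<^sup>1\<^sup>-\<^sup>\<beta>\<close> maps \<open>t\<^sup>\<beta> / \<Gamma>(1 + \<beta>)\<close> to the identity, subtracting \<open>c t\<^sup>\<beta> / \<Gamma>(1 + \<beta>)\<close>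
  from \<open>h\<close> lowers the derivative of the integral by \<open>c\<close>.\<close>

lemma AE_ge_of_RL_integral_deriv:
  assumes \<beta>: "0 < \<beta>" "\<beta> < 1" and \<delta>: "0 < \<delta>" and h: "set_integrable lebesgue {0..\<delta>} h"
    and int: "\<And>y. y \<in> {0..\<delta>} \<Longrightarrow> RL_integrable Plus 0 (1 - \<beta>) h y"
    and lim0: "(RL_integral Plus 0 (1 - \<beta>) h \<longlongrightarrow> 0) (at_right 0)"
    and deriv: "\<forall>\<^sub>F y in at_right 0. (RL_integral Plus 0 (1 - \<beta>) h has_real_derivative F' y) (at y)"
    and ge: "\<forall>\<^sub>F y in at_right 0. c \<le> F' y"
  shows "\<exists>\<eta>>0. AE u in lebesgue. 0 < u \<and> u < \<eta> \<longrightarrow> c / Gamma (1 + \<beta>) * u powr \<beta> \<le> h u"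
proof -
  define F where "F = RL_integral Plus 0 (1 - \<beta>) h"
  obtain \<eta>0 where "0 < \<eta>0" and
    F': "\<And>y. 0 < y \<Longrightarrow> y < \<eta>0 \<Longrightarrow> (F has_real_derivative F' y) (at y) \<and> c \<le> F' y"
    using eventually_conj[OF deriv ge] unfolding eventually_at_right_field F_def by auto
  \<comment> \<open>Halving gives \<open>\<eta> < \<eta>0\<close>, so \<open>F\<close> is
    differentiable at the right endpoint \<open>\<eta>\<close> too.\<close>
  define \<eta> where "\<eta> = min (\<eta>0 / 2) \<delta>"
  have \<eta>: "0 < \<eta>" "\<eta> < \<eta>0" "\<eta> \<le> \<delta>"
    using \<open>0 < \<eta>0\<close> \<delta> by (auto simp: \<eta>_def)
  define C where "C = c / Gamma (1 + \<beta>)"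
  define k where "k t = h t - C * t powr \<beta>" for t
  have RLp: "RL_integrable Plus 0 (1 - \<beta>) (\<lambda>t. t powr \<beta>) y" for y
    using \<beta> by (intro RL_integrable_powr[of _ \<beta>]) auto
  have G: "0 < Gamma (1 + \<beta>)"
    using \<beta> by (intro Gamma_real_pos) auto
  have RLk: "RL_integral Plus 0 (1 - \<beta>) k y = F y - c * y" if "y \<in> {0..\<eta>}" for y
  proof -
    have "RL_integral Plus 0 (1 - \<beta>) k y = F y - C * RL_integral Plus 0 (1 - \<beta>) (\<lambda>t. t powr \<beta>) y"
      unfolding k_def F_def using that \<eta>
      by (simp add: RL_integral_diff[OF int RL_integrable_cmult[OF RLp]] RL_integral_cmult)
    \<comment> \<open>The power rule gives the factor \<open>Gamma (1 + \<beta>) / Gamma 2\<close>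
      with \<open>Gamma 2 = 1\<close>, and the exponent
      \<open>\<beta> + (1 - \<beta>) = 1\<close>.\<close>
    also have "RL_integral Plus 0 (1 - \<beta>) (\<lambda>t. t powr \<beta>) y = Gamma (1 + \<beta>) * y"
    proof (cases "y = 0")
      case False
      then show ?thesis
        using RL_integral_powr[of "1 - \<beta>" \<beta> "\<lambda>t. t powr \<beta>" y] \<beta> that
        by (simp add: Gamma_numeral add.commute)
    qed simp
    finally show ?thesis using G by (simp add: C_def)
  qed
  \<comment> \<open>At 0 this combines \<open>lim0\<close> with the value \<open>F 0 = 0\<close>;
    elsewhere \<open>F\<close> is differentiable. It lets monotonicity reach down to 0.\<close>
  have "continuous_on {0..\<eta>} F"
    unfolding continuous_on_eq_continuous_within
  proof
    fix y assume y: "y \<in> {0..\<eta>}"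
    show "continuous (at y within {0..\<eta>}) F"
    proof (cases "y = 0")
      case True
      then show ?thesis
        using lim0 at_within_Icc_at_right[OF \<eta>(1)] by (simp add: continuous_within F_def)
    next
      case False
      then show ?thesis
        using F'[of y] y \<eta> DERIV_isCont[of F "F' y" y] continuous_at_imp_continuous_at_within by fastforce
    qed
  qed
  then have "continuous_on {0..\<eta>} (\<lambda>y. F y - c * y)"
    by (intro continuous_intros)
  then have "mono_on {0..\<eta>} (\<lambda>y. F y - c * y)"
  proof (intro mono_onI)
    fix r s assume cont: "continuous_on {0..\<eta>} (\<lambda>y. F y - c * y)"
      and rs: "r \<in> {0..\<eta>}" "s \<in> {0..\<eta>}" "r \<le> s"
    show "F r - c * r \<le> F s - c * s"
    proof (rule DERIV_nonneg_imp_increasing_open[OF rs(3)])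
      show "continuous_on {r..s} (\<lambda>y. F y - c * y)"
        using rs by (intro continuous_on_subset[OF cont]) auto
      show "\<exists>D. ((\<lambda>y. F y - c * y) has_real_derivative D) (at y) \<and> 0 \<le> D" if "r < y" "y < s" for y
        using F'[of y] that rs \<eta> by (intro exI[of _ "F' y - c"]) (auto intro!: derivative_eq_intros)
    qed
  qed
  then have "mono_on {0..\<eta>} (RL_integral Plus 0 (1 - \<beta>) k)"
    using RLk by (simp add: mono_on_def)
  moreover have "set_integrable lebesgue {0..\<eta>} k"
  proof -
    have "set_integrable lborel {0..\<eta>} (\<lambda>t. C * t powr \<beta>)"
      using \<beta> by (intro borel_integrable_atLeastAtMost' continuous_on_mult_left continuous_on_powr') auto
    then have "set_integrable lebesgue {0..\<eta>} (\<lambda>t. C * t powr \<beta>)"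
      unfolding set_integrable_def by (subst integrable_completion) auto
    then show ?thesis
      unfolding k_def using \<eta> by (intro set_integral_diff set_integrable_subset[OF h]) auto
  qed
  ultimately have "AE x in lebesgue. 0 < x \<and> x < \<eta> \<longrightarrow> 0 \<le> k x"
    using \<beta> by (intro AE_nonneg_of_mono_RL_integral[of "1 - \<beta>"]) auto
  then show ?thesis
    using \<eta> by (auto simp: k_def C_def)
qed

text \<open>The lower bound is applied to \<open>h\<close> with the constant
  \<open>D - e * G\<close> and to \<open>- h\<close> with \<open>- D - e * G\<close>. The tolerance
  carries the factor \<open>G\<close> because the bounds are divided by \<open>G\<close>.\<close>

lemma AE_velocity_bound:
  assumes \<beta>: "0 < \<beta>" "\<beta> < 1" and \<delta>: "0 < \<delta>" and h: "set_integrable lebesgue {0..\<delta>} h"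
    and int: "\<And>y. y \<in> {0..\<delta>} \<Longrightarrow> RL_integrable Plus 0 (1 - \<beta>) h y"
    and lim0: "(RL_integral Plus 0 (1 - \<beta>) h \<longlongrightarrow> 0) (at_right 0)"
    and deriv: "\<forall>\<^sub>F y in at_right 0. (RL_integral Plus 0 (1 - \<beta>) h has_real_derivative F' y) (at y)"
    and lim: "(F' \<longlongrightarrow> D) (at_right 0)" and e: "0 < e"
  shows "\<exists>\<eta>>0. AE u in lebesgue. 0 < u \<and> u < \<eta> \<longrightarrow> \<bar>h u / u powr \<beta> - D / Gamma (1 + \<beta>)\<bar> \<le> e"
proof -
  define G where "G = Gamma (1 + \<beta>)"
  have G: "0 < G"
    using \<beta> unfolding G_def by (intro Gamma_real_pos) auto
  have near: "\<forall>\<^sub>F y in at_right 0. \<bar>F' y - D\<bar> < e * G"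
    using tendstoD[OF lim, of "e * G"] e G by (simp add: dist_real_def)
  have minus: "RL_integral Plus 0 (1 - \<beta>) (\<lambda>t. - h t) = (\<lambda>y. - RL_integral Plus 0 (1 - \<beta>) h y)"
    using RL_integral_cmult[of Plus 0 "1 - \<beta>" "-1" h] by auto
  have "\<exists>\<eta>>0. AE u in lebesgue. 0 < u \<and> u < \<eta> \<longrightarrow> (D - e * G) / Gamma (1 + \<beta>) * u powr \<beta> \<le> h u"
  proof (rule AE_ge_of_RL_integral_deriv[OF \<beta> \<delta> h int lim0 deriv])
    show "\<forall>\<^sub>F y in at_right 0. D - e * G \<le> F' y"
      using near by eventually_elim linarith
  qed
  then obtain \<eta>1 where "0 < \<eta>1"
    and lo: "AE u in lebesgue. 0 < u \<and> u < \<eta>1 \<longrightarrow> (D - e * G) / G * u powr \<beta> \<le> h u"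
    by (auto simp: G_def)
  have "\<exists>\<eta>>0. AE u in lebesgue. 0 < u \<and> u < \<eta> \<longrightarrow> (- D - e * G) / Gamma (1 + \<beta>) * u powr \<beta> \<le> - h u"
  proof (rule AE_ge_of_RL_integral_deriv[OF \<beta> \<delta>, where F' = "\<lambda>y. - F' y"])
    show "set_integrable lebesgue {0..\<delta>} (\<lambda>t. - h t)"
      using set_integrable_mult_right[of "-1", OF h] by simp
    show "RL_integrable Plus 0 (1 - \<beta>) (\<lambda>t. - h t) y" if "y \<in> {0..\<delta>}" for y
      using RL_integrable_cmult[OF int[OF that], of "-1"] by simp
    show "(RL_integral Plus 0 (1 - \<beta>) (\<lambda>t. - h t) \<longlongrightarrow> 0) (at_right 0)"
      unfolding minus using tendsto_minus[OF lim0] by simp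
    show "\<forall>\<^sub>F y in at_right 0. (RL_integral Plus 0 (1 - \<beta>) (\<lambda>t. - h t) has_real_derivative - F' y) (at y)"
      using deriv unfolding minus by eventually_elim (rule DERIV_minus)
    show "\<forall>\<^sub>F y in at_right 0. - D - e * G \<le> - F' y"
      using near by eventually_elim linarith
  qed
  then obtain \<eta>2 where "0 < \<eta>2"
    and up: "AE u in lebesgue. 0 < u \<and> u < \<eta>2 \<longrightarrow> (- D - e * G) / G * u powr \<beta> \<le> - h u"
    by (auto simp: G_def)
  show ?thesis
  proof (intro exI[of _ "min \<eta>1 \<eta>2"] conjI)
    show "AE u in lebesgue. 0 < u \<and> u < min \<eta>1 \<eta>2 \<longrightarrow> \<bar>h u / u powr \<beta> - D / Gamma (1 + \<beta>)\<bar> \<le> e"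
      using lo up
    proof eventually_elim
      case (elim u)
      show ?case
      proof
        assume u: "0 < u \<and> u < min \<eta>1 \<eta>2"
        define w where "w = u powr \<beta>"
        have w: "0 < w" using u by (simp add: w_def)
        have "(D / G - e) * w \<le> h u" "h u \<le> (D / G + e) * w"
          using elim u G unfolding w_def[symmetric]
          by (simp_all add: diff_divide_distrib left_diff_distrib distrib_right)
        then have "D / G - e \<le> h u / w" "h u / w \<le> D / G + e"
          using w by (auto simp: pos_le_divide_eq pos_divide_le_eq)
        then show "\<bar>h u / u powr \<beta> - D / Gamma (1 + \<beta>)\<bar> \<le> e"
          unfolding w_def G_def by linarith
      qed
    qed
  qed (use \<open>0 < \<eta>1\<close> \<open>0 < \<eta>2\<close> in auto)
qed

section \<open>From almost everywhere bounds to a limit\<close>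

text \<open>The tolerances \<open>1 / real (Suc n)\<close> suffice, so countably many null sets are
  discarded at once. On their union the function is redefined as \<open>v * u powr \<beta>\<close>,
  whose quotient is exactly \<open>v\<close> for positive \<open>u\<close>.\<close>

lemma velocity_AE_version:
  fixes h :: "real \<Rightarrow> real"
  assumes "\<And>e. 0 < e \<Longrightarrow> \<exists>\<eta>>0. AE u in lebesgue. 0 < u \<and> u < \<eta> \<longrightarrow> \<bar>h u / u powr \<beta> - v\<bar> \<le> e"
  obtains h' where "h' 0 = h 0" "AE u in lebesgue. h' u = h u" "((\<lambda>u. h' u / u powr \<beta>) \<longlongrightarrow> v) (at_right 0)"
proof -
  have "\<forall>n. \<exists>\<eta>>0. AE u in lebesgue. 0 < u \<and> u < \<eta> \<longrightarrow> \<bar>h u / u powr \<beta> - v\<bar> \<le> 1 / real (Suc n)"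
    using assms by simp
  from choice[OF this] obtain \<eta> where \<eta>: "\<And>n. 0 < \<eta> n"
    and AE: "\<And>n. AE u in lebesgue. 0 < u \<and> u < \<eta> n \<longrightarrow> \<bar>h u / u powr \<beta> - v\<bar> \<le> 1 / real (Suc n)"
    by blast
  \<comment> \<open>For \<open>u \<le> 0\<close> the condition is vacuous, so the value at 0 is
    kept.\<close>
  define P where "P u \<longleftrightarrow> (\<forall>n. 0 < u \<and> u < \<eta> n \<longrightarrow> \<bar>h u / u powr \<beta> - v\<bar> \<le> 1 / real (Suc n))" for u
  define h' where "h' u = (if P u then h u else v * u powr \<beta>)" for u
  have "AE u in lebesgue. P u"
    unfolding P_def AE_all_countable using AE by blast
  then have "AE u in lebesgue. h' u = h u"
    by eventually_elim (simp add: h'_def)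
  moreover have "h' 0 = h 0"
    by (simp add: h'_def P_def)
  moreover have "((\<lambda>u. h' u / u powr \<beta>) \<longlongrightarrow> v) (at_right 0)"
  proof (rule tendstoI)
    fix e :: real assume "0 < e"
    then obtain n where n: "1 / real (Suc n) < e"
      using nat_approx_posE by blast
    have "\<forall>\<^sub>F u in at_right 0. u \<in> {0<..<\<eta> n}"
      using \<eta> by (rule eventually_at_right_real)
    then show "\<forall>\<^sub>F u in at_right 0. dist (h' u / u powr \<beta>) v < e"
    proof eventually_elim
      case (elim u)
      show ?case
      proof (cases "P u")
        case True
        then have "\<bar>h u / u powr \<beta> - v\<bar> \<le> 1 / real (Suc n)"
          using elim unfolding P_def by auto
        then show ?thesis
          using True n by (simp add: h'_def dist_real_def)
      next
        case False
        then show ?thesis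
          using elim \<open>0 < e\<close> by (simp add: h'_def)
      qed
    qed
  qed
  ultimately show thesis using that by blast
qed

text \<open>By continuity, a violation at \<open>u0\<close> would persist on a nonempty open set,
  which is not a null set.\<close>

lemma AE_bound_imp_bound_of_isCont:
  fixes r :: "real \<Rightarrow> real"
  assumes AE: "AE u in lebesgue. a < u \<and> u < b \<longrightarrow> r u \<le> e"
    and cont: "isCont r u0" and u0: "a < u0" "u0 < b"
  shows "r u0 \<le> e"
proof (rule ccontr)
  assume "\<not> r u0 \<le> e"
  then have "\<forall>\<^sub>F u in nhds u0. e < r u"
    using cont unfolding isCont_def tendsto_at_iff_tendsto_nhds by (intro order_tendstoD) auto
  moreover have "\<forall>\<^sub>F u in nhds u0. u \<in> {a<..<b}"
    using u0 by (intro eventually_nhds_in_open) auto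
  ultimately have "\<forall>\<^sub>F u in nhds u0. e < r u \<and> u \<in> {a<..<b}"
    by (rule eventually_conj)
  then obtain S where S: "open S" "u0 \<in> S" "\<And>u. u \<in> S \<Longrightarrow> e < r u \<and> u \<in> {a<..<b}"
    unfolding eventually_nhds by blast
  have "AE u in lebesgue. u \<notin> S"
    using AE
  proof eventually_elim
    case (elim u)
    then show ?case using S(3)[of u] by auto
  qed
  moreover have "S \<in> sets lebesgue"
    using S(1) by simp
  ultimately have "negligible S"
    unfolding negligible_iff_null_sets by (simp only: AE_iff_null_sets)
  then show False
    using open_not_negligible[OF S(1)] S(2) by blast
qed

text \<open>At points of continuity the almost everywhere bound holds without exception. It is taken
  with \<open>e / 2\<close> to obtain a strict inequality.\<close>

lemma velocity_of_isCont:
  fixes h :: "real \<Rightarrow> real"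
  assumes bound: "\<And>e. 0 < e \<Longrightarrow> \<exists>\<eta>>0. AE u in lebesgue. 0 < u \<and> u < \<eta> \<longrightarrow> \<bar>h u / u powr \<beta> - v\<bar> \<le> e"
    and cont: "\<forall>\<^sub>F u in at_right 0. isCont h u"
  shows "((\<lambda>u. h u / u powr \<beta>) \<longlongrightarrow> v) (at_right 0)"
proof (rule tendstoI)
  fix e :: real assume "0 < e"
  then obtain \<eta> where "0 < \<eta>"
    and AE: "AE u in lebesgue. 0 < u \<and> u < \<eta> \<longrightarrow> \<bar>h u / u powr \<beta> - v\<bar> \<le> e / 2"
    using bound[of "e / 2"] by auto
  have "\<forall>\<^sub>F u in at_right 0. u \<in> {0<..<\<eta>}"
    using \<open>0 < \<eta>\<close> by (rule eventually_at_right_real)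
  with cont show "\<forall>\<^sub>F u in at_right 0. dist (h u / u powr \<beta>) v < e"
  proof eventually_elim
    case (elim u)
    have "isCont (\<lambda>u. \<bar>h u / u powr \<beta> - v\<bar>) u"
      using elim by (intro continuous_intros) auto
    from AE_bound_imp_bound_of_isCont[OF AE this] elim \<open>0 < e\<close> show ?case
      by (auto simp: dist_real_def)
  qed
qed

subsection \<open>Reduction to the right-hand side of 0\<close>

text \<open>The map sending \<open>u\<close> to \<open>a + side_sign s * u\<close> carries the
  positive half-line to the chosen side of \<open>a\<close>, with Jacobian of absolute value
  1.\<close>

definition side_sign :: "side \<Rightarrow> real" where
  "side_sign s = (case s of Plus \<Rightarrow> 1 | Minus \<Rightarrow> -1)"

lemma side_sign_simps [simp]:
  "side_sign s \<noteq> 0" "\<bar>side_sign s\<bar> = 1"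
  by (cases s; simp add: side_sign_def)+

lemma KG_increment_eq: "KG_increment s f a t = side_sign s * (f t - f a)"
  by (cases s) (auto simp: side_sign_def)

lemma frac_diff_eq: "frac_diff s \<epsilon> f x = side_sign s * (f (x + side_sign s * \<epsilon>) - f x)"
  by (cases s) (auto simp: side_sign_def)

lemma RL_deriv_eq: "RL_deriv s a \<beta> g x = side_sign s * deriv (RL_integral s a (1 - \<beta>) g) x"
  by (cases s) (auto simp: side_sign_def)

lemma side_filter_eq: "side_filter s a = filtermap (\<lambda>u. a + side_sign s * u) (at_right 0)"
proof (cases s)
  case Plus
  then show ?thesis
    using filtermap_at_right_shift[of "-a" 0] by (simp add: side_sign_def add.commute)
next
  case Minus
  have "filtermap (\<lambda>u. a - u) (at_right 0) = filtermap (\<lambda>u. u + a) (filtermap uminus (at_right 0))"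
    by (simp add: filtermap_filtermap)
  also have "\<dots> = at_left a"
    using filtermap_at_left_shift[of "-a" 0] at_left_minus[of 0] by simp
  finally show ?thesis using Minus by (simp add: side_sign_def)
qed

lemma set_integrable_side_interval:
  fixes f :: "real \<Rightarrow> real"
  shows "set_integrable lebesgue (side_interval s a \<delta>) f \<longleftrightarrow>
    set_integrable lebesgue {0..\<delta>} (\<lambda>u. f (a + side_sign s * u))"
proof -
  have "indicator (side_interval s a \<delta>) (a + side_sign s * u) = (indicator {0..\<delta>} u :: real)" for u
    by (cases s) (auto simp: side_sign_def indicator_def)
  then show ?thesis
    using lebesgue_integrable_real_affine_iff[of "side_sign s" "\<lambda>x. indicator (side_interval s a \<delta>) x *\<^sub>R f x" a]
    by (simp add: set_integrable_def)
qed

text \<open>Under the change of variables, the kernel's distance \<open>x - t\<close> or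
  \<open>t - x\<close> becomes \<open>y - u\<close> for either sign.\<close>

lemma RL_integrand_side:
  "indicator (RL_domain s a (a + side_sign s * y)) (a + side_sign s * u) *\<^sub>R
      (g (a + side_sign s * u) * RL_kernel s \<alpha> (a + side_sign s * y) (a + side_sign s * u))
    = indicator (RL_domain Plus 0 y) u *\<^sub>R (g (a + side_sign s * u) * RL_kernel Plus \<alpha> y u)"
  by (cases s) (auto simp: side_sign_def indicator_def)

lemma RL_integrable_side:
  "RL_integrable s a \<alpha> g (a + side_sign s * y) \<longleftrightarrow>
    RL_integrable Plus 0 \<alpha> (\<lambda>u. g (a + side_sign s * u)) y"
  unfolding RL_integrable_def set_integrable_def RL_integrand_side[symmetric]
  by (rule lebesgue_integrable_real_affine_iff[symmetric]) simp

lemma RL_integral_side: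
  "RL_integral s a \<alpha> g (a + side_sign s * y) =
    RL_integral Plus 0 \<alpha> (\<lambda>u. g (a + side_sign s * u)) y"
  unfolding RL_integral_def set_lebesgue_integral_def RL_integrand_side[symmetric]
  by (subst lebesgue_integral_real_affine[of "side_sign s" _ a]) simp_all

text \<open>The new exceptional set lies in the image of the old one under an affine map, and
  differentiable maps send null sets to null sets.\<close>

lemma AE_lebesgue_real_affine:
  fixes c t :: real
  assumes "AE u in lebesgue. P u" "c \<noteq> 0"
  shows "AE x in lebesgue. P ((x - t) / c)"
proof -
  have "negligible ((\<lambda>u. t + c * u) ` {u. \<not> P u})"
  proof (rule negligible_differentiable_image_negligible)
    show "negligible {u. \<not> P u}"
      using assms(1) unfolding negligible_iff_null_sets
      by (simp add: completion.AE_iff_null_sets)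
  qed (auto intro!: derivative_intros)
  moreover have "{x \<in> space lebesgue. \<not> P ((x - t) / c)} \<subseteq> (\<lambda>u. t + c * u) ` {u. \<not> P u}"
    using assms(2) by (auto intro!: image_eqI[of _ _ "(x - t) / c" for x])
  ultimately show ?thesis
    by (intro AE_I') (simp_all add: negligible_iff_null_sets)
qed

section \<open>Continuity of the fractional integral at the base point\<close>

text \<open>A single interval (\<open>n = 1\<close>) in the definition suffices; \<open>min\<close>
  and \<open>max\<close> put its endpoints in the required order.\<close>

lemma abs_continuous_on_imp_continuous_on:
  assumes "abs_continuous_on {c..d} F"
  shows "continuous_on {c..d} F"
proof (rule continuous_onI)
  fix x e :: real assume x: "x \<in> {c..d}" and e: "0 < e"
  obtain \<eta> where "0 < \<eta>" and \<eta>: "\<And>(n::nat) u v.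
      (\<forall>i<n. u i \<le> v i \<and> u i \<in> {c..d} \<and> v i \<in> {c..d}) \<and>
      disjoint_family_on (\<lambda>i. {u i<..<v i}) {..<n} \<and> (\<Sum>i<n. v i - u i) < \<eta>
      \<Longrightarrow> (\<Sum>i<n. \<bar>F (v i) - F (u i)\<bar>) < e"
    using assms e unfolding abs_continuous_on_def by meson
  have "dist (F y) (F x) \<le> e" if y: "y \<in> {c..d}" "dist y x < \<eta>" for y
  proof -
    have "\<bar>F (max x y) - F (min x y)\<bar> < e"
      using \<eta>[of 1 "\<lambda>_. min x y" "\<lambda>_. max x y"] x y
      by (auto simp: disjoint_family_on_def dist_real_def min_def max_def)
    then show ?thesis
      by (auto simp: dist_real_def min_def max_def split: if_splits)
  qed
  then show "\<exists>d'>0. \<forall>x'\<in>{c..d}. dist x' x < d' \<longrightarrow> dist (F x') (F x) \<le> e"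
    using \<open>0 < \<eta>\<close> by blast
qed

text \<open>The integral has the value 0 at \<open>a\<close>, so continuity there is the claimed
  limit.\<close>

lemma tendsto_RL_integral_endpoint:
  assumes "0 < \<delta>" "abs_continuous_on (side_interval s a \<delta>) (RL_integral s a \<alpha> f)"
  shows "(RL_integral s a \<alpha> f \<longlongrightarrow> 0) (side_filter s a)"
proof (cases s)
  case Plus
  with assms have "continuous_on {a..a + \<delta>} (RL_integral s a \<alpha> f)"
    by (intro abs_continuous_on_imp_continuous_on) simp
  then have "continuous (at a within {a..a + \<delta>}) (RL_integral s a \<alpha> f)"
    using assms(1) by (simp add: continuous_on_eq_continuous_within)
  then show ?thesis
    using Plus assms(1) by (simp add: continuous_within at_within_Icc_at_right)
next
  case Minus
  with assms have "continuous_on {a - \<delta>..a} (RL_integral s a \<alpha> f)"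
    by (intro abs_continuous_on_imp_continuous_on) simp
  then have "continuous (at a within {a - \<delta>..a}) (RL_integral s a \<alpha> f)"
    using assms(1) by (simp add: continuous_on_eq_continuous_within)
  then show ?thesis
    using Minus assms(1) by (simp add: continuous_within at_within_Icc_at_left)
qed

theorem proposition8:
  fixes f :: "real \<Rightarrow> real" and a \<beta> \<delta> D :: real and s :: side
  assumes "0 < \<beta>" and "\<beta> < 1"
    and "has_KG_derivative s \<beta> f a D"
    and "\<delta> > 0"
    and "f \<in> summable_frac_deriv_space s \<beta> a (side_interval s a \<delta>)"
  shows "(\<exists>g. version_at a (side_interval s a \<delta>) f g \<and>
              beta_differentiable \<beta> g a \<and>
              (\<exists>v. has_frac_velocity s \<beta> g a v \<and> D = Gamma (1 + \<beta>) * v)) \<and>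
         ((\<forall>\<^sub>F x in side_filter s a. isCont f x) \<longrightarrow>
              beta_differentiable \<beta> f a \<and>
              (\<exists>v. has_frac_velocity s \<beta> f a v \<and> D = Gamma (1 + \<beta>) * v))"
proof -
  define \<sigma> where "\<sigma> = side_sign s"
  have \<sigma>[simp]: "\<sigma> \<noteq> 0" "\<sigma> * \<sigma> = 1" "\<sigma> * (\<sigma> * x) = x" "x / \<sigma> = \<sigma> * x" for x
    by (cases s; simp add: \<sigma>_def side_sign_def)+
  define f0 where "f0 u = f (a + \<sigma> * u)" for u
  define h where "h u = \<sigma> * (f0 u - f a)" for u
  let ?K = "KG_increment s f a"
  have h_K: "h = (\<lambda>u. ?K (a + \<sigma> * u))"
    by (simp add: fun_eq_iff h_def f0_def KG_increment_eq \<sigma>_def)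
  define F where "F = RL_integral Plus 0 (1 - \<beta>) h"
  have F_eq: "F y = RL_integral s a (1 - \<beta>) ?K (a + \<sigma> * y)" for y
    unfolding F_def h_K \<sigma>_def RL_integral_side ..
  define v where "v = D / Gamma (1 + \<beta>)"
  have "0 < Gamma (1 + \<beta>)"
    using assms(1) by (intro Gamma_real_pos) auto
  then have D: "D = Gamma (1 + \<beta>) * v"
    by (simp add: v_def)
  have f_int: "set_integrable lebesgue {0..\<delta>} f0"
    using assms(5) unfolding summable_frac_deriv_space_def set_integrable_side_interval f0_def \<sigma>_def by blast
  have f_RL: "RL_integrable Plus 0 (1 - \<beta>) f0 y" if "y \<in> {0..\<delta>}" for y
  proof -
    have "a + \<sigma> * y \<in> side_interval s a \<delta>"
      using that by (cases s) (auto simp: \<sigma>_def side_sign_def)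
    then show ?thesis
      using assms(5) unfolding summable_frac_deriv_space_def f0_def \<sigma>_def RL_integrable_side[symmetric] by blast
  qed
  have one: "RL_integrable Plus 0 (1 - \<beta>) (\<lambda>_. 1) y" for y
    using assms(2) by (intro RL_integrable_powr[of _ 0]) auto
  have const: "RL_integrable Plus 0 (1 - \<beta>) (\<lambda>_. f a) y" for y
    using RL_integrable_cmult[OF one, of "f a"] by simp
  have h_RL: "RL_integrable Plus 0 (1 - \<beta>) h y" if "y \<in> {0..\<delta>}" for y
    unfolding h_def by (intro RL_integrable_cmult RL_integrable_diff f_RL that const)
  have h_int: "set_integrable lebesgue {0..\<delta>} h"
    unfolding h_def by (intro set_integrable_mult_right set_integral_diff f_int
        absolutely_integrable_on_const) simp
  \<comment> \<open>Absolute continuity is given for the integral of \<open>f\<close>, not of its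
    increment. The constant \<open>f a\<close> contributes \<open>C * y powr (1 - \<beta>)\<close>,
    which also tends to 0 since \<open>\<beta> < 1\<close>.\<close>
  have lim0: "(F \<longlongrightarrow> 0) (at_right 0)"
  proof -
    define C where "C = f a / Gamma (2 - \<beta>)"
    let ?R = "\<lambda>y. \<sigma> * (RL_integral Plus 0 (1 - \<beta>) f0 y - C * y powr (1 - \<beta>))"
    have "((\<lambda>y. RL_integral s a (1 - \<beta>) f (a + \<sigma> * y)) \<longlongrightarrow> 0) (at_right 0)"
      using tendsto_RL_integral_endpoint[OF assms(4), of s a "1 - \<beta>" f] assms(5)
      unfolding summable_frac_deriv_space_def side_filter_eq \<sigma>_def filterlim_filtermap by blast
    then have "(RL_integral Plus 0 (1 - \<beta>) f0 \<longlongrightarrow> 0) (at_right 0)"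
      unfolding f0_def[abs_def] \<sigma>_def RL_integral_side .
    moreover have "((\<lambda>y::real. y powr (1 - \<beta>)) \<longlongrightarrow> 0) (at_right 0)"
      using assms(2) by (intro tendsto_zero_powrI[of _ _ _ "1 - \<beta>"] tendsto_const tendsto_ident_at)
        (auto simp: eventually_at_right_less intro: eventually_mono[OF eventually_at_right_less])
    ultimately have "(?R \<longlongrightarrow> \<sigma> * (0 - C * 0)) (at_right 0)"
      by (intro tendsto_intros)
    moreover have "\<forall>\<^sub>F y in at_right 0. ?R y = F y"
      using eventually_at_right_real[OF assms(4)]
    proof eventually_elim
      case (elim y)
      then have y: "y \<in> {0..\<delta>}" "0 < y" by auto
      have "RL_integral Plus 0 (1 - \<beta>) (\<lambda>_. f a) y = C * y powr (1 - \<beta>)"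
        using RL_integral_cmult[of Plus 0 "1 - \<beta>" "f a" "\<lambda>_. 1" y] assms(2) y(2)
          RL_integral_powr[of "1 - \<beta>" 0 "\<lambda>_. 1" y]
        by (simp add: C_def)
      then show ?case
        unfolding F_def h_def RL_integral_cmult RL_integral_diff[OF f_RL[OF y(1)] const] by simp
    qed
    ultimately show ?thesis
      by (simp add: Lim_transform_eventually)
  qed
  have deriv: "\<forall>\<^sub>F y in at_right 0. (F has_real_derivative RL_deriv s a \<beta> ?K (a + \<sigma> * y)) (at y)"
  proof -
    have "\<forall>\<^sub>F y in at_right 0. RL_differentiable s a \<beta> ?K (a + \<sigma> * y)"
      using assms(3) unfolding has_KG_derivative_def side_filter_eq eventually_filtermap \<sigma>_def by blast
    then show ?thesis
    proof eventually_elim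
      case (elim y)
      let ?I = "RL_integral s a (1 - \<beta>) ?K"
      have "(?I has_real_derivative deriv ?I (a + \<sigma> * y)) (at (a + \<sigma> * y))"
        using elim unfolding RL_differentiable_def DERIV_deriv_iff_real_differentiable by blast
      \<comment> \<open>The chain rule contributes a factor \<open>\<sigma>\<close>, which is
        exactly the sign built into \<open>RL_deriv\<close>.\<close>
      then have "((\<lambda>y. ?I (a + \<sigma> * y)) has_real_derivative deriv ?I (a + \<sigma> * y) * \<sigma>) (at y)"
        by (rule DERIV_chain2) (auto intro!: derivative_eq_intros)
      then show ?case
        unfolding F_eq[abs_def] RL_deriv_eq \<sigma>_def by (simp add: mult.commute)
    qed
  qed
  have lim: "((\<lambda>y. RL_deriv s a \<beta> ?K (a + \<sigma> * y)) \<longlongrightarrow> D) (at_right 0)"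
    using assms(3) unfolding has_KG_derivative_def side_filter_eq \<sigma>_def filterlim_filtermap by blast
  note bound = AE_velocity_bound[OF assms(1,2,4) h_int h_RL lim0[unfolded F_def] deriv[unfolded F_def] lim, folded v_def]
  obtain h' where h': "h' 0 = h 0" "AE u in lebesgue. h' u = h u"
      "((\<lambda>u. h' u / u powr \<beta>) \<longlongrightarrow> v) (at_right 0)"
    by (rule velocity_AE_version[OF bound])
  \<comment> \<open>Since \<open>\<sigma> * \<sigma> = 1\<close>, the same sign undoes both the
    reflection of the argument and the sign of the increment.\<close>
  define g where "g x = f a + \<sigma> * h' (\<sigma> * (x - a))" for x
  have ga: "g a = f a"
    by (simp add: g_def h'(1)) (simp add: h_def f0_def)
  have "AE x in lebesgue. h' (\<sigma> * (x - a)) = h (\<sigma> * (x - a))"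
    using AE_lebesgue_real_affine[OF h'(2), of \<sigma> a] by simp
  then have "AE x in lebesgue. g x = f x"
    by eventually_elim (simp add: g_def h_def f0_def)
  then have "version_at a (side_interval s a \<delta>) f g"
    using ga unfolding version_at_def by auto
  moreover have "frac_diff s \<epsilon> g a = h' \<epsilon>" for \<epsilon>
    by (simp add: frac_diff_eq ga flip: \<sigma>_def) (simp add: g_def)
  then have "has_frac_velocity s \<beta> g a v"
    using h'(3) by (simp add: has_frac_velocity_def)
  moreover have "has_frac_velocity s \<beta> f a v" if cont: "\<forall>\<^sub>F x in side_filter s a. isCont f x"
  proof -
    have "\<forall>\<^sub>F u in at_right 0. isCont f (a + \<sigma> * u)"
      using cont unfolding side_filter_eq eventually_filtermap \<sigma>_def .
    then have "\<forall>\<^sub>F u in at_right 0. isCont h u"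
    proof eventually_elim
      case (elim u)
      then show ?case
        unfolding h_def f0_def by (intro continuous_intros isCont_o2[of u "\<lambda>u. a + \<sigma> * u" f])
    qed
    then have "((\<lambda>u. h u / u powr \<beta>) \<longlongrightarrow> v) (at_right 0)"
      by (intro velocity_of_isCont bound)
    moreover have "frac_diff s \<epsilon> f a = h \<epsilon>" for \<epsilon>
      by (simp add: frac_diff_eq h_def f0_def \<sigma>_def)
    ultimately show ?thesis
      by (simp add: has_frac_velocity_def)
  qed
  ultimately show ?thesis
    using D unfolding beta_differentiable_def by blast
qed

end
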